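(* Let $N\ge1$ be an integer and suppose $a>\max\{0,2-N\}$. Let $v=v(t,x)$ be a real-valued function on $[0,\infty)\times\mathbb{R}^N$ satisfying: 1. $v$ is continuous on $[0,\infty)\times\mathbb{R}^N$; 2. $v$ is of class $C^1$ in $t$; 3. $v$ is of class $C^2$ in $x$ on $\mathbb{R}^N\setminus\{0\}$; 4. the initial value $v_0(x):=v(0,x)$ is bounded from above on $\mathbb{R}^N$; 5. $v(t,0)\le\sup_{x\in\mathbb{R}^N}v_0(x)$ for all $t\ge0$; 6. for any $T>0$ there exist $k>0$, $R>0$ and $C>0$ such that $v(t,x)\le C(1+|x|^{ka})$ for all $t\in[0,T]$ and $|x|>R$; 7. $v_t=\frac1a|x|^{2-a}\Delta v$ (for $x\ne0$). Then $$\sup_{(t,x)\in[0,\infty)\times\mathbb{R}^N}v(t,x)\le\sup_{x\in\mathbb{R}^N}v_0(x).$$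
   Context: $\Delta$ is the Euclidean Laplacian in the variable $x\in\mathbb{R}^N$ and $v_t=\partial v/\partial t$ (one-sided at $t=0$). *)

theory Defs
  imports "HOL-Analysis.Analysis"
begin

text \<open>\<open>at t within S\<close> makes derivatives one-sided at the endpoints of an interval \<open>S\<close>;
  the library's \<open>C1_differentiable_on\<close> asks for two-sided derivatives there.\<close>

definition C1_within :: "real set \<Rightarrow> (real \<Rightarrow> real) \<Rightarrow> bool" where
  "C1_within S g \<longleftrightarrow>
     (\<exists>g'. (\<forall>t\<in>S. (g has_real_derivative g' t) (at t within S)) \<and> continuous_on S g')"

definition partial_deriv :: "'n::finite \<Rightarrow> (real^'n \<Rightarrow> real) \<Rightarrow> real^'n \<Rightarrow> real" where
  "partial_deriv i f x = deriv (\<lambda>s. f (x + s *\<^sub>R axis i 1)) 0"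

text \<open>The next two definitions are meant for open \<open>S\<close>. Differentiability along the axes is
  required explicitly because \<^const>\<open>deriv\<close> is total.\<close>

definition C1_on :: "(real^'n::finite) set \<Rightarrow> (real^'n \<Rightarrow> real) \<Rightarrow> bool" where
  "C1_on S f \<longleftrightarrow>
     (\<forall>i. (\<forall>x\<in>S. (\<lambda>s. f (x + s *\<^sub>R axis i 1)) differentiable (at 0)) \<and>
          continuous_on S (partial_deriv i f))"

definition C2_on :: "(real^'n::finite) set \<Rightarrow> (real^'n \<Rightarrow> real) \<Rightarrow> bool" where
  "C2_on S f \<longleftrightarrow> C1_on S f \<and> (\<forall>i. C1_on S (partial_deriv i f))"

definition laplacian :: "(real^'n::finite \<Rightarrow> real) \<Rightarrow> real^'n \<Rightarrow> real" where
  "laplacian f x = (\<Sum>i\<in>UNIV. partial_deriv i (partial_deriv i f) x)"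

end

theory Submission
  imports Defs
begin

text \<open>The function \<open>w = exp (\<lambda> t) (1 + |x|^a)^m\<close> is a strict supersolution once \<open>\<lambda>\<close> is
  large: in the variable \<open>s = |x|^a\<close> the operator \<open>(1/a) |x|^(2-a) \<Delta>\<close> becomes
  \<open>(a + N - 2) d/ds + a s d\<^sup>2/ds\<^sup>2\<close>, which has no singularity at \<open>s = 0\<close>. For \<open>m > k\<close> it
  dominates \<open>v\<close> at infinity, so a positive value of \<open>v - sup v\<^sub>0 - \<epsilon> w\<close> would force a positive
  maximum over \<open>[0,T] \<times> \<real>\<^sup>N\<close>, at a point with \<open>t > 0\<close> and \<open>x \<noteq> 0\<close>, contradicting the equation.\<close>

section \<open>Second-order conditions at a maximum\<close>

text \<open>At the maximum \<open>g'\<close> vanishes. If \<open>c\<close> were positive,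
  \<open>g'\<close> would be positive just to the right of \<open>x\<close>, so \<open>g\<close>
  would increase strictly there.\<close>

lemma second_deriv_local_max:
  fixes g g' :: "real \<Rightarrow> real"
  assumes "d > 0"
    and g: "\<And>s. \<bar>s - x\<bar> < d \<Longrightarrow> (g has_real_derivative g' s) (at s)"
    and g': "(g' has_real_derivative c) (at x)"
    and max: "\<And>s. \<bar>s - x\<bar> < d \<Longrightarrow> g s \<le> g x"
  shows "c \<le> 0"
proof (rule ccontr)
  assume "\<not> c \<le> 0"
  have "g' x = 0"
    using DERIV_local_max[OF g[of x] \<open>d > 0\<close>] max \<open>d > 0\<close> by (simp add: abs_minus_commute)
  moreover obtain e where e: "e > 0" "\<And>h. h > 0 \<Longrightarrow> h < e \<Longrightarrow> g' x < g' (x + h)"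
    using DERIV_pos_inc_right[OF g'] \<open>\<not> c \<le> 0\<close> by auto
  ultimately have pos: "\<And>h. h > 0 \<Longrightarrow> h < e \<Longrightarrow> 0 < g' (x + h)"
    by simp
  define h where "h = min d e / 2"
  have h: "h > 0" "h < d" "h < e"
    using \<open>d > 0\<close> \<open>e > 0\<close> by (auto simp: h_def min_def)
  have incr: "\<exists>y. (g has_real_derivative y) (at s) \<and> y > 0" if "x < s" "s < x + h" for s
    using g[of s] pos[of "s - x"] that h by (intro exI[of _ "g' s"]) auto
  have "continuous_on {x..x + h} g"
    using g h by (intro continuous_at_imp_continuous_on ballI DERIV_isCont[OF g]) auto
  with h have "g x < g (x + h)"
    by (intro DERIV_pos_imp_increasing_open[OF _ incr]) simp_all
  then show False
    using max[of "x + h"] h by simp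
qed

text \<open>\<open>C1_on\<close> speaks of the parameter value 0 only; moving the base point along
  the axis turns this into a derivative at any parameter whose point lies in
  \<open>S\<close>.\<close>

lemma C1_on_deriv_along_axis:
  fixes f :: "real^'n::finite \<Rightarrow> real"
  assumes "C1_on S f" and "x + s *\<^sub>R axis i 1 \<in> S"
  shows "((\<lambda>\<sigma>. f (x + \<sigma> *\<^sub>R axis i 1)) has_real_derivative
            partial_deriv i f (x + s *\<^sub>R axis i 1)) (at s)"
proof -
  let ?y = "x + s *\<^sub>R axis i 1"
  have "(\<lambda>\<sigma>. f (?y + \<sigma> *\<^sub>R axis i 1)) differentiable (at 0)"
    using assms unfolding C1_on_def by blast
  then have "((\<lambda>\<sigma>. f (?y + \<sigma> *\<^sub>R axis i 1)) has_real_derivative partial_deriv i f ?y) (at 0)"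
    unfolding partial_deriv_def using DERIV_deriv_iff_real_differentiable by blast
  moreover have "(\<lambda>\<sigma>. f (?y + \<sigma> *\<^sub>R axis i 1)) = (\<lambda>\<sigma>. f (x + (\<sigma> + s) *\<^sub>R axis i 1))"
    by (simp add: algebra_simps)
  ultimately show ?thesis
    using DERIV_shift[of "\<lambda>\<sigma>. f (x + \<sigma> *\<^sub>R axis i 1)" "partial_deriv i f ?y" 0 s] by simp
qed

text \<open>The right-hand side is the Laplacian of the radial function
  \<open>p (y \<bullet> y)\<close> at \<open>x\<close>. The second derivative test is applied along
  each axis through \<open>x\<close>, where \<open>y \<bullet> y\<close> is a quadratic polynomial
  in the parameter, and the results are summed.\<close>

lemma laplacian_le_radial_at_max:
  fixes f :: "real^'n::finite \<Rightarrow> real" and x :: "real^'n"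
  assumes C2: "C2_on (UNIV - {0}) f" and "x \<noteq> 0"
    and p: "\<And>q. q > 0 \<Longrightarrow> (p has_real_derivative p' q) (at q)"
    and p': "\<And>q. q > 0 \<Longrightarrow> (p' has_real_derivative p'' q) (at q)"
    and max: "\<And>y. f y - p (y \<bullet> y) \<le> f x - p (x \<bullet> x)"
  shows "laplacian f x \<le> 4 * (x \<bullet> x) * p'' (x \<bullet> x) + 2 * real CARD('n) * p' (x \<bullet> x)"
proof -
  let ?Q = "x \<bullet> x"
  have "partial_deriv i (partial_deriv i f) x \<le> 4 * (x $ i)\<^sup>2 * p'' ?Q + 2 * p' ?Q" for i
  proof -
    define y where "y = (\<lambda>s. x + s *\<^sub>R (axis i 1 :: real^'n))"
    define h where "h = (\<lambda>s. ?Q + 2 * s * x $ i + s\<^sup>2)"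
    have yy: "y s \<bullet> y s = h s" for s
      by (simp add: y_def h_def inner_add_left inner_add_right inner_axis inner_axis'
          power2_eq_square algebra_simps)
    have y0: "y 0 = x" "h 0 = ?Q" by (simp_all add: y_def h_def)
    have dh: "(h has_real_derivative 2 * x $ i + 2 * s) (at s)" for s
      unfolding h_def by (auto intro!: derivative_eq_intros)
    \<comment> \<open>Axis vectors have norm 1, so a shift by less than \<open>norm x\<close> cannot
      reach the origin, where neither \<open>f\<close> nor \<open>p\<close> is controlled.\<close>
    have ne: "y s \<noteq> 0" if "\<bar>s\<bar> < norm x" for s
    proof
      assume "y s = 0"
      then have "x = - (s *\<^sub>R axis i 1)"
        by (simp add: y_def eq_neg_iff_add_eq_0)
      then show False using that by (simp add: norm_axis_1)
    qed
    have hpos: "h s > 0" if "\<bar>s\<bar> < norm x" for s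
      using ne[OF that] by (simp flip: yy)
    have C1: "C1_on (UNIV - {0}) f" "C1_on (UNIV - {0}) (partial_deriv i f)"
      using C2 by (auto simp: C2_on_def)
    let ?g = "\<lambda>s. f (y s) - p (h s)"
    let ?g' = "\<lambda>s. partial_deriv i f (y s) - p' (h s) * (2 * x $ i + 2 * s)"
    have "(?g has_real_derivative ?g' s) (at s)" if "\<bar>s - 0\<bar> < norm x" for s
      using C1_on_deriv_along_axis[OF C1(1), of x s i] ne[of s] that
        DERIV_chain2[OF p[OF hpos[of s]] dh[of s]]
      by (intro DERIV_diff) (auto simp: y_def)
    moreover have "(?g' has_real_derivative partial_deriv i (partial_deriv i f) x
        - (4 * (x $ i)\<^sup>2 * p'' ?Q + 2 * p' ?Q)) (at 0)"
    proof -
      have "((\<lambda>s. partial_deriv i f (y s)) has_real_derivative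
          partial_deriv i (partial_deriv i f) x) (at 0)"
        using C1_on_deriv_along_axis[OF C1(2), of x 0 i] \<open>x \<noteq> 0\<close> by (simp add: y_def)
      moreover have "((\<lambda>s. p' (h s)) has_real_derivative p'' (h 0) * (2 * x $ i + 2 * 0)) (at 0)"
        using DERIV_chain2[OF p'[OF hpos[of 0]] dh[of 0]] \<open>x \<noteq> 0\<close> by simp
      ultimately show ?thesis
        by (auto intro!: derivative_eq_intros simp: y0 power2_eq_square)
    qed
    ultimately have "partial_deriv i (partial_deriv i f) x
        - (4 * (x $ i)\<^sup>2 * p'' ?Q + 2 * p' ?Q) \<le> 0"
      using max[of "y _"] \<open>x \<noteq> 0\<close> by (intro second_deriv_local_max[of "norm x" 0 ?g ?g']) (auto simp: yy y0)
    then show ?thesis by simp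
  qed
  then have "laplacian f x \<le> (\<Sum>i\<in>UNIV. 4 * (x $ i)\<^sup>2 * p'' ?Q + 2 * p' ?Q)"
    unfolding laplacian_def by (intro sum_mono)
  also have "\<dots> = 4 * ?Q * p'' ?Q + 2 * real CARD('n) * p' ?Q"
    by (simp add: sum.distrib inner_vec_def power2_eq_square flip: sum_distrib_left sum_distrib_right)
  finally show ?thesis .
qed

section \<open>The radial barrier and its growth\<close>

text \<open>The argument \<open>q\<close> stands for \<open>|x|\<^sup>2\<close> and \<open>b\<close> for \<open>a/2\<close>; the exponent \<open>m = n + 2\<close> keeps
  \<open>m - 1\<close> and \<open>m - 2\<close> free of truncated subtraction.\<close>

definition barrier :: "real \<Rightarrow> nat \<Rightarrow> real \<Rightarrow> real" where
  "barrier b n q = (1 + q powr b) ^ (n + 2)"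

definition barrier' :: "real \<Rightarrow> nat \<Rightarrow> real \<Rightarrow> real" where
  "barrier' b n q = real (n + 2) * (1 + q powr b) ^ (n + 1) * (b * q powr (b - 1))"

definition barrier'' :: "real \<Rightarrow> nat \<Rightarrow> real \<Rightarrow> real" where
  "barrier'' b n q =
     real (n + 2) * real (n + 1) * (1 + q powr b) ^ n * (b * q powr (b - 1))\<^sup>2
     + real (n + 2) * (1 + q powr b) ^ (n + 1) * (b * (b - 1) * q powr (b - 2))"

lemma has_real_derivative_powr_add_one:
  fixes q :: real
  assumes "q > 0"
  shows "((\<lambda>q. (1 + q powr b) ^ Suc j) has_real_derivative
            real (Suc j) * (1 + q powr b) ^ j * (b * q powr (b - 1))) (at q)"
proof -
  have "((\<lambda>q. 1 + q powr b) has_real_derivative b * q powr (b - 1)) (at q)"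
    using DERIV_add[OF DERIV_const has_real_derivative_powr[OF assms]] by simp
  from DERIV_power[OF this, of "Suc j"] show ?thesis
    by (rule DERIV_cong) simp
qed

lemma barrier_deriv:
  assumes "q > 0"
  shows "(barrier b n has_real_derivative barrier' b n q) (at q)"
  using has_real_derivative_powr_add_one[OF assms, of b "Suc n"]
  unfolding barrier_def[abs_def] barrier'_def by simp

lemma barrier'_deriv:
  assumes "q > 0"
  shows "(barrier' b n has_real_derivative barrier'' b n q) (at q)"
proof -
  have "((\<lambda>q. b * q powr (b - 1)) has_real_derivative b * (b - 1) * q powr (b - 2)) (at q)"
    using DERIV_cmult[OF has_real_derivative_powr[OF assms, of "b - 1"], of b]
    by (simp add: algebra_simps)
  from DERIV_mult[OF DERIV_cmult[OF has_real_derivative_powr_add_one[OF assms, of b n],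
        of "real (n + 2)"] this]
  show ?thesis
    unfolding barrier'_def[abs_def] barrier''_def
    by (simp add: power2_eq_square algebra_simps)
qed

text \<open>With \<open>q = |x|^2\<close> the left side is the spatial operator applied to the
  barrier. For \<open>s = q powr (a/2)\<close> and \<open>m = n + 2\<close> it collapses to
  \<open>a m (m-1) s (1+s)^(m-2) + m (a+N-2) (1+s)^(m-1)\<close>. Both coefficients are nonnegative
  and both powers are at most \<open>(1+s)^m\<close>; the extra 1 makes the bound strict.\<close>

lemma barrier_supersolution:
  fixes a N q :: real
  assumes "a > 0" "a + N - 2 > 0" "q > 0"
  shows "1 / a * q powr (1 - a / 2) *
           (4 * q * barrier'' (a / 2) n q + 2 * N * barrier' (a / 2) n q)
         < (a * real (n + 2) * real (n + 1) + real (n + 2) * (a + N - 2) + 1) * barrier (a / 2) n q"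
proof -
  define b where "b = a / 2"
  define s where "s = q powr b"
  define m where "m = real (n + 2)"
  have a: "a = 2 * b" "b > 0" using assms by (simp_all add: b_def)
  have "s > 0" using assms by (simp add: s_def)
  have "m > 0" by (simp add: m_def)
  \<comment> \<open>Once every power is expressed through \<open>s\<close>, the expression is
    rational in \<open>q\<close> and \<open>s\<close>, and \<open>q\<close> cancels.\<close>
  have p1: "q powr (b - 1) = s / q" "q powr (b - 2) = s / q\<^sup>2" "q powr (1 - b) = q / s"
    using assms by (simp_all add: s_def powr_diff)
  have "1 / a * q powr (1 - b) * (4 * q * barrier'' b n q + 2 * N * barrier' b n q)
      = a * m * real (n + 1) * (s * (1 + s) ^ n) + m * (a + N - 2) * (1 + s) ^ (n + 1)"
    using assms(3) a \<open>s > 0\<close>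
    unfolding barrier''_def barrier'_def p1 s_def[symmetric] m_def[symmetric]
    by (simp add: field_simps power2_eq_square)
  also have "\<dots> \<le> a * m * real (n + 1) * (1 + s) ^ (n + 2) + m * (a + N - 2) * (1 + s) ^ (n + 2)"
  proof (intro add_mono mult_left_mono)
    have "s * (1 + s) ^ n \<le> (1 + s) * (1 + s) ^ n"
      using \<open>s > 0\<close> by (intro mult_right_mono) auto
    also have "\<dots> \<le> (1 + s) ^ (n + 2)"
      using \<open>s > 0\<close> power_increasing[of "n + 1" "n + 2" "1 + s"] by simp
    finally show "s * (1 + s) ^ n \<le> (1 + s) ^ (n + 2)" .
    show "(1 + s) ^ (n + 1) \<le> (1 + s) ^ (n + 2)"
      using \<open>s > 0\<close> by (intro power_increasing) auto
  qed (use assms \<open>m > 0\<close> in auto)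
  also have "\<dots> < (a * m * real (n + 1) + m * (a + N - 2) + 1) * (1 + s) ^ (n + 2)"
    using zero_less_power[of "1 + s" "n + 2"] \<open>s > 0\<close> by (simp only: distrib_right) simp
  finally show ?thesis
    by (simp add: barrier_def b_def s_def m_def)
qed

text \<open>Both 1 and \<open>s powr k\<close> are at most \<open>(1 + s) powr k\<close>, and one
  further factor \<open>1 + s\<close> absorbs the constant \<open>2 * C / \<epsilon>\<close>. It is
  applied with \<open>s = |x|^a\<close>.\<close>

lemma powr_growth_eventually_le_power:
  fixes C \<epsilon> k :: real
  assumes "C > 0" "\<epsilon> > 0" "k \<ge> 0" "k + 1 \<le> real m" "s \<ge> 2 * C / \<epsilon>"
  shows "C * (1 + s powr k) \<le> \<epsilon> * (1 + s) ^ m"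
proof -
  have "s > 0" using assms by (smt (verit) divide_pos_pos)
  have "1 \<le> (1 + s) powr k" "s powr k \<le> (1 + s) powr k"
    using \<open>s > 0\<close> assms by (auto intro!: ge_one_powr_ge_zero powr_mono2)
  then have "C * (1 + s powr k) \<le> C * (2 * (1 + s) powr k)"
    using assms by (intro mult_left_mono) auto
  also have "\<dots> \<le> \<epsilon> * (1 + s) * (1 + s) powr k"
  proof -
    have "2 * C \<le> \<epsilon> * (1 + s)"
      using assms by (simp add: field_simps)
    from mult_right_mono[OF this, of "(1 + s) powr k"] show ?thesis
      by (simp add: mult_ac)
  qed
  also have "\<dots> = \<epsilon> * (1 + s) powr (k + 1)"
    using \<open>s > 0\<close> by (simp add: powr_add)
  also have "\<dots> \<le> \<epsilon> * (1 + s) powr real m"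
    using \<open>s > 0\<close> assms by (intro mult_left_mono powr_mono) auto
  also have "\<dots> = \<epsilon> * (1 + s) ^ m"
    using \<open>s > 0\<close> by (simp add: powr_realpow)
  finally show ?thesis .
qed

text \<open>The value 0 of \<open>f\<close> is included, since the maximum is taken over a ball
  containing the origin; \<open>b > 0\<close> gives continuity there.\<close>

lemma continuous_on_barrier:
  fixes f :: "'a::topological_space \<Rightarrow> real"
  assumes "b > 0" "continuous_on S f" "\<And>x. x \<in> S \<Longrightarrow> f x \<ge> 0"
  shows "continuous_on S (\<lambda>x. barrier b n (f x))"
  unfolding barrier_def using assms by (intro continuous_intros continuous_on_powr') auto

section \<open>The maximum principle\<close>

theorem theorem4p20:
  fixes v :: "real \<Rightarrow> real^'n::finite \<Rightarrow> real" and a :: real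
  assumes "a > max 0 (2 - real CARD('n))"
    and "continuous_on ({0..} \<times> UNIV) (\<lambda>(t, x). v t x)"
    and "\<And>x. C1_within {0..} (\<lambda>t. v t x)"
    and "\<And>t. t \<ge> 0 \<Longrightarrow> C2_on (UNIV - {0}) (v t)"
    and "bdd_above (range (v 0))"
    and "\<And>t. t \<ge> 0 \<Longrightarrow> ereal (v t 0) \<le> (SUP x. ereal (v 0 x))"
    and "\<And>T::real. T > 0 \<Longrightarrow>
           \<exists>k>0. \<exists>R>0. \<exists>C>0. \<forall>t\<in>{0..T}. \<forall>x. norm x > R \<longrightarrow>
             v t x \<le> C * (1 + norm x powr (k * a))"
    and "\<And>t x. t \<ge> 0 \<Longrightarrow> x \<noteq> 0 \<Longrightarrow>
           ((\<lambda>s. v s x) has_real_derivative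
              1 / a * norm x powr (2 - a) * laplacian (v t) x) (at t within {0..})"
  shows "(SUP (t, x)\<in>{0..} \<times> UNIV. ereal (v t x)) \<le> (SUP x. ereal (v 0 x))"
proof -
  let ?N = "real CARD('n)"
  have a: "a > 0" "a + ?N - 2 > 0" using assms(1) by auto
  \<comment> \<open>The supremum is shown to be a real number \<open>M\<close>, which reduces the
    claim to pointwise bounds \<open>v T z \<le> M\<close>.\<close>
  have "(SUP x. ereal (v 0 x)) \<noteq> \<infinity>"
  proof -
    obtain B where "\<And>x. v 0 x \<le> B"
      using assms(5) by (auto simp: bdd_above_def)
    then have "(SUP x. ereal (v 0 x)) \<le> ereal B"
      by (intro SUP_least) auto
    then show ?thesis by auto
  qed
  moreover have "(SUP x. ereal (v 0 x)) \<noteq> -\<infinity>"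
    using SUP_upper[of 0 UNIV "\<lambda>x. ereal (v 0 x)"] by auto
  ultimately obtain M where M: "(SUP x. ereal (v 0 x)) = ereal M"
    by (cases "SUP x. ereal (v 0 x)") auto
  have v0: "v 0 x \<le> M" for x
    using SUP_upper[of x UNIV "\<lambda>x. ereal (v 0 x)"] M by simp
  have origin: "v t 0 \<le> M" if "t \<ge> 0" for t
    using assms(6)[OF that] M by simp
  have "v T z \<le> M" if "T \<ge> 0" for T z
  proof (rule ccontr)
    assume "\<not> v T z \<le> M"
    then have vT: "v T z > M" by simp
    then have "T > 0" using v0[of z] that by (cases "T = 0") auto
    obtain k R C where k: "k > 0" "R > 0" "C > 0" and
      grow: "\<And>t x. t \<in> {0..T} \<Longrightarrow> norm x > R \<Longrightarrow> v t x \<le> C * (1 + norm x powr (k * a))"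
      using assms(7)[OF \<open>T > 0\<close>] by blast
    \<comment> \<open>The barrier exponent \<open>n + 2\<close> then exceeds \<open>k + 1\<close>,
      as the growth comparison requires.\<close>
    obtain n :: nat where n: "k \<le> real n" using real_arch_simple by blast
    \<comment> \<open>This is the growth rate from \<open>barrier_supersolution\<close> with
      \<open>N\<close> the dimension.\<close>
    define l where "l = a * real (n + 2) * real (n + 1) + real (n + 2) * (a + ?N - 2) + 1"
    define w where "w = (\<lambda>x::real^'n. barrier (a / 2) n (x \<bullet> x))"
    have w: "w x = (1 + norm x powr a) ^ (n + 2)" for x
    proof -
      have "(x \<bullet> x) powr (a / 2) = norm x powr a"
        by (simp add: dot_square_norm powr_half_sqrt powr_powr
            flip: powr_numeral)
      then show ?thesis by (simp add: w_def barrier_def)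
    qed
    have w1: "w x \<ge> 1" for x unfolding w by (intro one_le_power) simp
    have "l > 0" using a by (auto simp: l_def intro!: add_nonneg_pos add_nonneg_nonneg)
    \<comment> \<open>With this choice the barrier term at \<open>(T, z)\<close> is half of
      \<open>v T z - M\<close>, so \<open>u T z\<close> stays positive.\<close>
    define \<epsilon> where "\<epsilon> = (v T z - M) / (2 * exp (l * T) * w z)"
    have "w z > 0" using w1[of z] by simp
    then have "\<epsilon> > 0" using vT by (simp add: \<epsilon>_def)
    define u where "u = (\<lambda>t x. v t x - M - \<epsilon> * exp (l * t) * w x)"
    have uz: "u T z > 0"
      using vT \<open>w z > 0\<close> by (simp add: u_def \<epsilon>_def)
    define D where "D = C + \<bar>M\<bar>"
    \<comment> \<open>The first entry puts \<open>x\<close> in the range of the growth bound; the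
      second forces \<open>norm x powr a \<ge> 2 * D / \<epsilon>\<close>. The
      \<open>\<bar>M\<bar>\<close> in \<open>D\<close> pays for subtracting
      \<open>M\<close>.\<close>
    define \<rho> where "\<rho> = max (R + 1) ((2 * D / \<epsilon>) powr (1 / a))"
    have "D > 0" using k by (simp add: D_def)
    have far: "u t x \<le> 0" if t: "t \<in> {0..T}" and x: "norm x > \<rho>" for t x
    proof -
      have "2 * D / \<epsilon> = ((2 * D / \<epsilon>) powr (1 / a)) powr a"
        using a \<open>D > 0\<close> \<open>\<epsilon> > 0\<close> by (simp add: powr_powr)
      also have "\<dots> \<le> norm x powr a"
        using a x by (intro powr_mono2) (auto simp: \<rho>_def)
      finally have big: "norm x powr a \<ge> 2 * D / \<epsilon>" .
      have "v t x - M \<le> C * (1 + norm x powr (k * a)) + \<bar>M\<bar> * (1 + norm x powr (k * a))"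
      proof -
        have "\<bar>M\<bar> * 1 \<le> \<bar>M\<bar> * (1 + norm x powr (k * a))"
          by (intro mult_left_mono) auto
        then show ?thesis using grow[OF t, of x] x by (auto simp: \<rho>_def)
      qed
      also have "\<dots> = D * (1 + (norm x powr a) powr k)"
        by (simp add: D_def distrib_right powr_powr mult.commute)
      also have "\<dots> \<le> \<epsilon> * w x"
        unfolding w using \<open>D > 0\<close> \<open>\<epsilon> > 0\<close> k n big
        by (intro powr_growth_eventually_le_power) auto
      also have "\<dots> \<le> \<epsilon> * exp (l * t) * w x"
        using t \<open>\<epsilon> > 0\<close> \<open>l > 0\<close> w1[of x] by simp
      finally show ?thesis by (simp add: u_def)
    qed
    have "\<exists>p\<in>{0..T} \<times> cball 0 \<rho>. \<forall>q\<in>{0..T} \<times> cball 0 \<rho>.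
        (case q of (t, x) \<Rightarrow> u t x) \<le> (case p of (t, x) \<Rightarrow> u t x)"
    proof (rule continuous_attains_sup)
      show "{0..T} \<times> cball (0::real^'n) \<rho> \<noteq> {}"
        using \<open>T > 0\<close> k by (simp add: \<rho>_def)
      have "continuous_on ({0..T} \<times> cball 0 \<rho>) (\<lambda>p. v (fst p) (snd p))"
        using assms(2) unfolding case_prod_unfold by (rule continuous_on_subset) auto
      moreover have "continuous_on ({0..T} \<times> cball 0 \<rho>) (\<lambda>p. w (snd p))"
        unfolding w_def using a by (intro continuous_on_barrier continuous_intros) auto
      ultimately show "continuous_on ({0..T} \<times> cball 0 \<rho>) (\<lambda>(t, x). u t x)"
        unfolding u_def case_prod_unfold by (intro continuous_intros)
    qed (intro compact_Times compact_Icc compact_cball)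
    then obtain t0 x0 where p: "t0 \<in> {0..T}" "x0 \<in> cball 0 \<rho>"
      and pmax: "\<And>t x. t \<in> {0..T} \<Longrightarrow> x \<in> cball 0 \<rho> \<Longrightarrow> u t x \<le> u t0 x0"
      by auto
    have "z \<in> cball 0 \<rho>"
      using far[of T z] uz \<open>T > 0\<close> by (auto simp: not_less[symmetric])
    then have u0: "u t0 x0 > 0"
      using pmax[of T z] uz \<open>T > 0\<close> by simp
    \<comment> \<open>Outside the ball \<open>u \<le> 0 < u t0 x0\<close>, so the maximum over the
      compact cylinder is global in \<open>x\<close>.\<close>
    have umax: "u t x \<le> u t0 x0" if "t \<in> {0..T}" for t x
      using pmax[OF that, of x] far[OF that, of x] u0 by (cases "norm x > \<rho>") auto
    have vpos: "v t0 x0 > M"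
    proof -
      have "\<epsilon> * exp (l * t0) * w x0 \<ge> 0"
        using \<open>\<epsilon> > 0\<close> w1[of x0] by simp
      then show ?thesis using u0 by (simp add: u_def)
    qed
    \<comment> \<open>The bounds by \<open>M\<close> at the origin and at time 0 exclude both
      places, so the equation holds at \<open>x0\<close> and there is room to step back in
      time.\<close>
    have "x0 \<noteq> 0" using origin[of t0] vpos p by auto
    have "t0 > 0" using v0[of x0] vpos p by (cases "t0 = 0") auto
    define E where "E = \<epsilon> * exp (l * t0)"
    have "E > 0" using \<open>\<epsilon> > 0\<close> by (simp add: E_def)
    let ?q = "x0 \<bullet> x0"
    let ?c = "1 / a * norm x0 powr (2 - a)"
    have "?q > 0" using \<open>x0 \<noteq> 0\<close> by simp
    have qn: "norm x0 powr (2 - a) = ?q powr (1 - a / 2)"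
      by (simp add: dot_square_norm powr_powr algebra_simps flip: powr_numeral)
    \<comment> \<open>At the fixed time \<open>t0\<close> the time factor is the constant
      \<open>E\<close>, so \<open>p\<close> is \<open>E\<close> times the barrier.\<close>
    have "laplacian (v t0) x0 \<le>
        4 * ?q * (E * barrier'' (a / 2) n ?q) + 2 * ?N * (E * barrier' (a / 2) n ?q)"
    proof (rule laplacian_le_radial_at_max)
      show "C2_on (UNIV - {0}) (v t0)" using assms(4) p by simp
      show "v t0 y - E * barrier (a / 2) n (y \<bullet> y) \<le> v t0 x0 - E * barrier (a / 2) n ?q" for y
        using umax[of t0 y] p by (simp add: u_def w_def E_def)
    qed (use \<open>x0 \<noteq> 0\<close> in \<open>auto intro!: DERIV_cmult barrier_deriv barrier'_deriv\<close>)
    then have "?c * laplacian (v t0) x0 \<le>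
        ?c * (E * (4 * ?q * barrier'' (a / 2) n ?q + 2 * ?N * barrier' (a / 2) n ?q))"
      using a by (intro mult_left_mono) (auto simp: algebra_simps)
    also have "\<dots> = E * (1 / a * ?q powr (1 - a / 2) *
        (4 * ?q * barrier'' (a / 2) n ?q + 2 * ?N * barrier' (a / 2) n ?q))"
      by (simp add: qn)
    also have "\<dots> < E * (l * w x0)"
      using barrier_supersolution[OF a \<open>?q > 0\<close>, of n] \<open>E > 0\<close>
      by (intro mult_strict_left_mono) (simp_all only: l_def w_def)
    finally have neg: "?c * laplacian (v t0) x0 - E * l * w x0 < 0"
      by (simp add: mult.assoc)
    \<comment> \<open>As \<open>t0 > 0\<close> is interior to the half-line, the derivative within
      it is two-sided.\<close>
    have "((\<lambda>t. v t x0) has_real_derivative ?c * laplacian (v t0) x0) (at t0)"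
      using assms(8)[of t0 x0] \<open>t0 > 0\<close> \<open>x0 \<noteq> 0\<close> by (simp add: at_within_interior[of t0 "{0..}"])
    moreover have "((\<lambda>t. \<epsilon> * exp (l * t) * w x0) has_real_derivative E * l * w x0) (at t0)"
      unfolding E_def by (auto intro!: derivative_eq_intros)
    ultimately have "((\<lambda>t. u t x0) has_real_derivative
        ?c * laplacian (v t0) x0 - E * l * w x0) (at t0)"
      unfolding u_def using DERIV_diff[OF DERIV_diff[OF _ DERIV_const]] by fastforce
    \<comment> \<open>The contradiction is sought at earlier times, which remain in
      \<open>{0..T}\<close> even when \<open>t0 = T\<close>.\<close>
    from DERIV_neg_dec_left[OF this neg] obtain d where "d > 0"
      and d: "\<And>h. h > 0 \<Longrightarrow> h < d \<Longrightarrow> u t0 x0 < u (t0 - h) x0" by auto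
    define h where "h = min d t0 / 2"
    have "h > 0" "h < d" "h \<le> t0"
      using \<open>d > 0\<close> \<open>t0 > 0\<close> by (auto simp: h_def min_def)
    then show False
      using d[of h] umax[of "t0 - h" x0] p by auto
  qed
  then show ?thesis
    unfolding M by (intro SUP_least) auto
qed

end
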